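(* Let $\lambda$ be an infinite cardinal and assume $2^{<\lambda}>\lambda$. Then there is a continuous weak $\lambda^+$-measure space $({}^{\lambda}2,\mathfrak{M},\mu)$ on ${}^{\lambda}2$ (with $\mu$ taking values in some positively totally ordered monoid $\mathbb{S}$ with an infinitary sum $\mathsf{Sum}$).
   Context: **Topology.** ${}^{\lambda}2$ is the set of functions from $\lambda$ to $2=\{0,1\}$, with the bounded topology, generated by the cones $\mathbf{N}_s=\{x\in{}^{\lambda}2\mid s\subseteq x\}$ for $s\in{}^{<\lambda}2=\bigcup_{\alpha<\lambda}{}^{\alpha}2$. $2^{<\lambda}=\sup\{2^{\theta}\mid\theta<\lambda\text{ a cardinal}\}$. **Monoids and sums.** A positively totally ordered monoid is $\mathbb{S}=(S,0,+,\leq)$ where $+$ is associative (not necessarily commutative) with neutral element $0$, $\leq$ is a total order, $a\leq b$ and $c\leq d$ imply $a+c\leq b+d$, $0$ is the minimum of $\leq$, and $S\neq\{0\}$. ${}^{<\mathrm{On}}\mathbb{S}$ is the class of all sequences of elements of $S$ of ordinal length; $\mathrm{lh}(s)$ is the length of $s$. An infinitary sum on $\mathbb{S}$ is a partial function $\mathsf{Sum}:{}^{<\mathrm{On}}\mathbb{S}\to\mathbb{S}$ such that: (S1) $\mathsf{Sum}(\emptyset)=0$ and $\mathsf{Sum}(s)=s_0+\dots+s_n$ for every non-empty finite $s=(s_i)_{i\leq n}\in\mathrm{dom}(\mathsf{Sum})$; (S2) (continuity) for all $s\in\mathrm{dom}(\mathsf{Sum})$ of limit length, if $s\restriction\alpha\in\mathrm{dom}(\mathsf{Sum})$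 for cofinally many $\alpha<\mathrm{lh}(s)$, then $\mathsf{Sum}(s)=\sup\{\mathsf{Sum}(s\restriction\alpha)\mid\alpha<\mathrm{lh}(s),\ s\restriction\alpha\in\mathrm{dom}(\mathsf{Sum})\}$. **Measures.** A weakly $\lambda^+$-measurable space is a pair $(X,\mathfrak{M})$ where $X$ is a topological space and $\mathfrak{M}$ is a family of subsets of $X$ closed under unions of size $\leq\lambda$ and containing all open subsets of $X$. A $\lambda^+$-measure on it (with values in $(\mathbb{S},\mathsf{Sum})$) is a partial function $\mu:\mathscr{P}(X)\to\mathbb{S}$ with $\mathfrak{M}\subseteq\mathrm{dom}(\mu)$ such that: (M1) $\mu(\emptyset)=0$; (M2) $\mu(X)>0$; (M3) $A\subseteq B$ implies $\mu(A)\leq\mu(B)$ for all $A,B\in\mathfrak{M}$; (M4) for every family $(A_i)_{i<\gamma}$ of pairwise disjoint sets of $\mathfrak{M}$ of length an ordinal $\gamma<\lambda^+$, we have $\langle\mu(A_i)\mid i<\gamma\rangle\in\mathrm{dom}(\mathsf{Sum})$ and $\mu(\bigcup_{i<\gamma}A_i)=\mathsf{Sum}(\langle\mu(A_i)\mid i<\gamma\rangle)$; (M5) for every $x\in X$ with $\{x\}\in\mathfrak{M}$ and every open local basis $\{A_i\mid i<\gamma\}$ at $x$ with $\gamma<\lambda^+$, $\mu(\{x\})=\inf_{i<\gamma}\mu(A_i)$. Then $(X,\mathfrak{M},\mu)$ is called a weak $\lambda^+$-measure space. It is continuous if $\{x\}\in\mathfrak{M}$ and $\mu(\{x\})=0$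 for every $x\in X$. *)

theory Defs
  imports "HOL-Analysis.Abstract_Topology" "HOL-Algebra.Group"
    "HOL-Library.Disjoint_Sets"
begin

unbundle cardinal_syntax

text \<open>
  Cardinals are those of the BNF library: a cardinal is a well-order \<open>r\<close> with
  \<open>Card_order r\<close>, the ordinals below it are the elements \<open>a\<close> of \<open>Field r\<close>, and the
  ordinal \<open>a\<close> is identified with its set of predecessors \<open>underS r a\<close>.
\<close>

definition is_card_sup :: "'a rel set \<Rightarrow> 'a rel \<Rightarrow> bool" where
  "is_card_sup C k \<longleftrightarrow>
     Card_order k \<and> (\<forall>c\<in>C. c \<le>o k) \<and>
     (\<forall>k' :: 'a rel. Card_order k' \<longrightarrow> (\<forall>c\<in>C. c \<le>o k') \<longrightarrow> k \<le>o k')"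

text \<open>
  The cardinal \<open>2\<^sup>< \<^sup>\<lambda>\<close>, determined up to \<open>=o\<close>. Every cardinal below \<open>lam\<close> has a
  representative of type \<open>'a rel\<close>.
\<close>

definition two_pow_less :: "'a rel \<Rightarrow> ('a \<Rightarrow> bool) rel" where
  "two_pow_less lam =
     (SOME k. is_card_sup {ctwo ^c t | t :: 'a rel. Card_order t \<and> t <o lam} k)"

lemma is_card_sup_two_pow_less:
  fixes lam :: "'a rel"
  shows "is_card_sup {ctwo ^c t | t :: 'a rel. Card_order t \<and> t <o lam} (two_pow_less lam)"
proof -
  let ?C = "{ctwo ^c t | t :: 'a rel. Card_order t \<and> t <o lam}"
  let ?R = "{k :: ('a \<Rightarrow> bool) rel. Card_order k \<and> (\<forall>c\<in>?C. c \<le>o k)}"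
  have "|UNIV :: ('a \<Rightarrow> bool) set| \<in> ?R"
    by ((auto simp: cexp_def card_of_Card_order intro!: card_of_mono1))
  then have "\<exists>k\<in>?R. \<forall>k'\<in>?R. k \<le>o k'"
    by (intro exists_minim_Card_order) auto
  then have "\<exists>k. is_card_sup ?C k"
    unfolding is_card_sup_def by auto
  then show ?thesis
    unfolding two_pow_less_def by (rule someI_ex)
qed

text \<open>
  The space of functions from \<open>\<lambda>\<close> to 2, as extensional functions on \<open>Field lam\<close>. For infinite
  \<open>lam\<close> every ordinal below \<open>\<lambda>\<close> is of the form \<open>underS lam a\<close>, so \<open>s\<close> below ranges over all
  of \<open>\<^sup>< \<^sup>\<lambda>2\<close>.
\<close>

definition two_space :: "'a rel \<Rightarrow> ('a \<Rightarrow> bool) set" where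
  "two_space lam = Field lam \<rightarrow>\<^sub>E (UNIV :: bool set)"

definition basic_cone :: "'a rel \<Rightarrow> 'a \<Rightarrow> ('a \<Rightarrow> bool) \<Rightarrow> ('a \<Rightarrow> bool) set" where
  "basic_cone lam a s = {x \<in> two_space lam. restrict x (underS lam a) = s}"

definition bounded_topology :: "'a rel \<Rightarrow> ('a \<Rightarrow> bool) topology" where
  "bounded_topology lam =
     topology_generated_by
       {basic_cone lam a s | a s. a \<in> Field lam \<and> s \<in> underS lam a \<rightarrow>\<^sub>E (UNIV :: bool set)}"

lemma topspace_bounded_topology:
  assumes "Field lam \<noteq> {}"
  shows "topspace (bounded_topology lam) = two_space lam"
proof -
  let ?cones = "{basic_cone lam a s | a s. a \<in> Field lam \<and> s \<in> underS lam a \<rightarrow>\<^sub>E (UNIV :: bool set)}"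
  obtain a where a: "a \<in> Field lam"
    using assms by blast
  have "\<Union>?cones = two_space lam"
  proof (rule subset_antisym; rule subsetI)
    fix x assume "x \<in> \<Union>?cones"
    then show "x \<in> two_space lam"
      by (auto simp only: basic_cone_def)
  next
    fix x assume x: "x \<in> two_space lam"
    have "restrict x (underS lam a) \<in> underS lam a \<rightarrow>\<^sub>E (UNIV :: bool set)"
      by simp
    with a have "basic_cone lam a (restrict x (underS lam a)) \<in> ?cones"
      by (intro CollectI exI conjI) (rule refl)
    moreover have "x \<in> basic_cone lam a (restrict x (underS lam a))"
      using x by (simp add: basic_cone_def)
    ultimately show "x \<in> \<Union>?cones"
      by (rule UnionI)
  qed
  then show ?thesis
    by (simp only: bounded_topology_def topology_generated_by_topspace)
qed

text \<open>
  The monoid operation and neutral element are inherited from the library record and hence written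
  \<open>\<otimes>\<close> and \<open>\<one>\<close>, although they are thought of additively, as \<open>+\<close> and \<open>0\<close>.
\<close>

record 's pto_monoid = "'s monoid" +
  leq :: "'s rel"

definition positively_totally_ordered_monoid :: "'s pto_monoid \<Rightarrow> bool" where
  "positively_totally_ordered_monoid S \<longleftrightarrow>
     Group.monoid S \<and>
     linear_order_on (carrier S) (leq S) \<and>
     (\<forall>a b c d. (a, b) \<in> leq S \<longrightarrow> (c, d) \<in> leq S \<longrightarrow> (a \<otimes>\<^bsub>S\<^esub> c, b \<otimes>\<^bsub>S\<^esub> d) \<in> leq S) \<and>
     (\<forall>a\<in>carrier S. (\<one>\<^bsub>S\<^esub>, a) \<in> leq S) \<and>
     carrier S \<noteq> {\<one>\<^bsub>S\<^esub>}"

definition is_sup :: "'s pto_monoid \<Rightarrow> 's set \<Rightarrow> 's \<Rightarrow> bool" where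
  "is_sup S A v \<longleftrightarrow>
     v \<in> carrier S \<and> (\<forall>a\<in>A. (a, v) \<in> leq S) \<and>
     (\<forall>w\<in>carrier S. (\<forall>a\<in>A. (a, w) \<in> leq S) \<longrightarrow> (v, w) \<in> leq S)"

definition is_inf :: "'s pto_monoid \<Rightarrow> 's set \<Rightarrow> 's \<Rightarrow> bool" where
  "is_inf S A v \<longleftrightarrow>
     v \<in> carrier S \<and> (\<forall>a\<in>A. (v, a) \<in> leq S) \<and>
     (\<forall>w\<in>carrier S. (\<forall>a\<in>A. (w, a) \<in> leq S) \<longrightarrow> (w, v) \<in> leq S)"

text \<open>
  The class of all ordinals is replaced by a well-order \<open>W\<close>, whose elements serve as lengths: a
  sequence is a pair of its length \<open>a\<close> and an extensional function on \<open>underS W a\<close>. An infinitary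
  sum relative to \<open>W\<close> is a partial function on all ordinal sequences which is undefined on the
  sequences of length at least \<open>W\<close>. Restricting the domain of an infinitary sum to
  lengths below \<open>W\<close> preserves both axioms. For \<open>\<lambda>\<^sup>+\<close>-measures, \<open>W\<close> is \<open>\<lambda>\<^sup>+\<close>.
\<close>

definition ord_seqs :: "'o rel \<Rightarrow> 's set \<Rightarrow> ('o \<times> ('o \<Rightarrow> 's)) set" where
  "ord_seqs W A = (SIGMA a:Field W. underS W a \<rightarrow>\<^sub>E A)"

definition limit_ord :: "'o rel \<Rightarrow> 'o \<Rightarrow> bool" where
  "limit_ord W a \<longleftrightarrow>
     underS W a \<noteq> {} \<and> (\<forall>b\<in>underS W a. \<exists>c\<in>underS W a. b \<in> underS W c)"

text \<open>
  In the second clause, \<open>l\<close> is the increasing enumeration of the (then finite) length \<open>a\<close>. The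
  last clause is continuity.
\<close>

definition infinitary_sum ::
    "'o rel \<Rightarrow> 's pto_monoid \<Rightarrow> ('o \<times> ('o \<Rightarrow> 's) \<rightharpoonup> 's) \<Rightarrow> bool" where
  "infinitary_sum W S ssum \<longleftrightarrow>
     dom ssum \<subseteq> ord_seqs W (carrier S) \<and> ran ssum \<subseteq> carrier S \<and>
     (\<forall>a s. (a, s) \<in> ord_seqs W (carrier S) \<longrightarrow> underS W a = {} \<longrightarrow> ssum (a, s) = Some \<one>\<^bsub>S\<^esub>) \<and>
     (\<forall>a s l. (a, s) \<in> dom ssum \<longrightarrow> l \<noteq> [] \<longrightarrow> set l = underS W a \<longrightarrow>
        sorted_wrt (\<lambda>i j. i \<in> underS W j) l \<longrightarrow>
        ssum (a, s) = Some (foldr (\<otimes>\<^bsub>S\<^esub>) (map s l) \<one>\<^bsub>S\<^esub>)) \<and>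
     (\<forall>a s. (a, s) \<in> dom ssum \<longrightarrow> limit_ord W a \<longrightarrow>
        (\<forall>b\<in>underS W a. \<exists>c\<in>underS W a. (b, c) \<in> W \<and> (c, restrict s (underS W c)) \<in> dom ssum) \<longrightarrow>
        is_sup S {v. \<exists>c\<in>underS W a. ssum (c, restrict s (underS W c)) = Some v}
          (the (ssum (a, s))))"

definition weakly_measurable_space :: "'a rel \<Rightarrow> 'x topology \<Rightarrow> 'x set set \<Rightarrow> bool" where
  "weakly_measurable_space lam X M \<longleftrightarrow>
     M \<subseteq> Pow (topspace X) \<and>
     (\<forall>F. F \<subseteq> M \<longrightarrow> |F| \<le>o lam \<longrightarrow> \<Union>F \<in> M) \<and>
     (\<forall>U. openin X U \<longrightarrow> U \<in> M)"

definition open_local_basis :: "'x topology \<Rightarrow> 'x \<Rightarrow> 'x set set \<Rightarrow> bool" where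
  "open_local_basis X x B \<longleftrightarrow>
     (\<forall>U\<in>B. openin X U \<and> x \<in> U) \<and>
     (\<forall>V. openin X V \<longrightarrow> x \<in> V \<longrightarrow> (\<exists>U\<in>B. U \<subseteq> V))"

definition weak_measure_space ::
    "'a rel \<Rightarrow> 's pto_monoid \<Rightarrow> ('a set \<times> ('a set \<Rightarrow> 's) \<rightharpoonup> 's) \<Rightarrow>
     'x topology \<Rightarrow> 'x set set \<Rightarrow> ('x set \<rightharpoonup> 's) \<Rightarrow> bool" where
  "weak_measure_space lam S ssum X M mu \<longleftrightarrow>
     weakly_measurable_space lam X M \<and>
     M \<subseteq> dom mu \<and> dom mu \<subseteq> Pow (topspace X) \<and> ran mu \<subseteq> carrier S \<and>
     mu {} = Some \<one>\<^bsub>S\<^esub> \<and>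
     (\<one>\<^bsub>S\<^esub>, the (mu (topspace X))) \<in> leq S \<and> the (mu (topspace X)) \<noteq> \<one>\<^bsub>S\<^esub> \<and>
     (\<forall>A\<in>M. \<forall>B\<in>M. A \<subseteq> B \<longrightarrow> (the (mu A), the (mu B)) \<in> leq S) \<and>
     (\<forall>g\<in>Field (cardSuc lam). \<forall>A :: 'a set \<Rightarrow> 'x set.
        (\<forall>i\<in>underS (cardSuc lam) g. A i \<in> M) \<longrightarrow>
        disjoint_family_on A (underS (cardSuc lam) g) \<longrightarrow>
        (g, \<lambda>i\<in>underS (cardSuc lam) g. the (mu (A i))) \<in> dom ssum \<and>
        mu (\<Union>i\<in>underS (cardSuc lam) g. A i) =
          ssum (g, \<lambda>i\<in>underS (cardSuc lam) g. the (mu (A i)))) \<and>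
     (\<forall>x\<in>topspace X. {x} \<in> M \<longrightarrow>
        (\<forall>g\<in>Field (cardSuc lam). \<forall>A :: 'a set \<Rightarrow> 'x set.
           open_local_basis X x (A ` underS (cardSuc lam) g) \<longrightarrow>
           is_inf S ((\<lambda>i. the (mu (A i))) ` underS (cardSuc lam) g) (the (mu {x}))))"

definition continuous_measure ::
    "'s pto_monoid \<Rightarrow> 'x topology \<Rightarrow> 'x set set \<Rightarrow> ('x set \<rightharpoonup> 's) \<Rightarrow> bool" where
  "continuous_measure S X M mu \<longleftrightarrow> (\<forall>x\<in>topspace X. {x} \<in> M \<and> mu {x} = Some \<one>\<^bsub>S\<^esub>)"

text \<open>
  An existential statement about a value monoid has to fix the type of its elements. For measures on
  the space of functions from \<open>\<lambda>\<close> to 2, subsets of that space suffice: the submonoid generated by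
  the values \<open>\<mu>(A)\<close>, \<open>A \<in> M\<close>, has at most \<open>2\<close> to the power \<open>2\<^sup>\<lambda>\<close> elements, and \<open>\<mu>\<close> can be
  restricted to \<open>M\<close> and the sum to the sequences of measures of disjoint families of length
  below \<open>\<lambda>\<^sup>+\<close>; these are closed under initial segments, so the axioms are preserved.
\<close>

type_synonym 'a value_monoid = "('a \<Rightarrow> bool) set pto_monoid"

end

theory Submission
  imports Defs
begin

text \<open>
  For \<open>A \<subseteq> \<^sup>\<lambda>2\<close> consider the set of levels \<open>a < \<lambda>\<close> on which the tree generated by \<open>A\<close> has more
  than \<open>\<lambda>\<close> nodes. This is a final segment of \<open>\<lambda>\<close>, it turns unions of size at most \<open>\<lambda>\<close> into
  unions, it is empty for singletons, and it omits \<open>a\<close> for the cones of level \<open>a\<close>, so that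
  along a local basis the intersection is empty. It is nonempty for the whole space exactly
  because \<open>2\<^sup>< \<^sup>\<lambda> > \<lambda>\<close>. Hence it is a measure with values in the chain of final segments, with
  union as addition and as infinitary sum.
\<close>

section \<open>Final segments and the set of wide levels\<close>

definition final_segments :: "'a rel \<Rightarrow> 'a set set" where
  "final_segments r = {U. U \<subseteq> Field r \<and> (\<forall>a\<in>U. \<forall>b. (a, b) \<in> r \<longrightarrow> b \<in> U)}"

definition wide_levels :: "'a rel \<Rightarrow> ('a \<Rightarrow> bool) set \<Rightarrow> 'a set" where
  "wide_levels r A = {a \<in> Field r. \<not> |(\<lambda>x. restrict x (underS r a)) ` A| \<le>o r}"

lemma empty_in_final_segments: "{} \<in> final_segments r"
  by (simp add: final_segments_def)

lemma Field_in_final_segments: "Field r \<in> final_segments r"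
  by (auto simp: final_segments_def Field_def)

lemma Un_in_final_segments:
  "U \<in> final_segments r \<Longrightarrow> V \<in> final_segments r \<Longrightarrow> U \<union> V \<in> final_segments r"
  by (auto simp: final_segments_def)

lemma UN_in_final_segments:
  "(\<And>i. i \<in> I \<Longrightarrow> U i \<in> final_segments r) \<Longrightarrow> (\<Union>i\<in>I. U i) \<in> final_segments r"
  by (fastforce simp: final_segments_def)

lemma final_segments_chain:
  assumes "Total r" "U \<in> final_segments r" "V \<in> final_segments r"
  shows "U \<subseteq> V \<or> V \<subseteq> U"
proof (rule ccontr)
  assume "\<not> ?thesis"
  then obtain a b where ab: "a \<in> U" "a \<notin> V" "b \<in> V" "b \<notin> U" by blast
  then have "a \<in> Field r" "b \<in> Field r" "a \<noteq> b"
    using assms(2,3) by (auto simp: final_segments_def)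
  then have "(a, b) \<in> r \<or> (b, a) \<in> r"
    using assms(1) by (auto simp: total_on_def)
  with ab assms show False by (auto simp: final_segments_def)
qed

lemma underS_mono_trans_antisym:
  assumes "trans r" "antisym r" "(a, b) \<in> r"
  shows "underS r a \<subseteq> underS r b"
  using assms unfolding underS_def by (auto dest: transD antisymD)

text \<open>Nodes on level \<open>a\<close> are restrictions of nodes on any later level
  \<open>b\<close>, so the number of nodes cannot drop from \<open>a\<close> to
  \<open>b\<close>.\<close>

lemma wide_levels_final_segment:
  assumes "trans r" "antisym r"
  shows "wide_levels r A \<in> final_segments r"
  unfolding final_segments_def
proof (intro CollectI conjI ballI allI impI)
  show "wide_levels r A \<subseteq> Field r" by (auto simp: wide_levels_def)
  fix a b assume a: "a \<in> wide_levels r A" and ab: "(a, b) \<in> r"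
  have sub: "underS r a \<inter> underS r b = underS r a"
    using underS_mono_trans_antisym[OF assms ab] by blast
  have "(\<lambda>x. restrict x (underS r a)) ` A
      = (\<lambda>x. restrict x (underS r a)) ` (\<lambda>x. restrict x (underS r b)) ` A"
    using sub by (simp add: image_image Int_commute)
  then have "|(\<lambda>x. restrict x (underS r a)) ` A| \<le>o |(\<lambda>x. restrict x (underS r b)) ` A|"
    by (metis card_of_image)
  with a ab show "b \<in> wide_levels r A"
    by (auto simp: wide_levels_def Field_def dest: ordLeq_transitive)
qed

lemma wide_levels_mono: "A \<subseteq> B \<Longrightarrow> wide_levels r A \<subseteq> wide_levels r B"
  unfolding wide_levels_def by (auto dest: ordLeq_transitive[OF card_of_mono1[OF image_mono]])

text \<open>If level \<open>a\<close> is narrow for each \<open>A i\<close>, its nodes for the union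
  form a union of at most \<open>r\<close> sets of size at most \<open>r\<close>, and such a union
  again has size at most \<open>r\<close> because \<open>r\<close> is infinite.\<close>

lemma wide_levels_UN:
  assumes "Card_order r" "infinite (Field r)" "|I| \<le>o r"
  shows "wide_levels r (\<Union>i\<in>I. A i) = (\<Union>i\<in>I. wide_levels r (A i))"
proof
  show "(\<Union>i\<in>I. wide_levels r (A i)) \<subseteq> wide_levels r (\<Union>i\<in>I. A i)"
    by (intro UN_least wide_levels_mono UN_upper)
  show "wide_levels r (\<Union>i\<in>I. A i) \<subseteq> (\<Union>i\<in>I. wide_levels r (A i))"
    using card_of_UNION_ordLeq_infinite_Field[OF assms(2,1,3)]
    by (fastforce simp: wide_levels_def image_UN)
qed

text \<open>Since \<open>Field r\<close> is infinite, a finite level is never wide. This serves both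
  for finite sets, such as points, and for a cone at its own level, where at most one node is
  left.\<close>

lemma not_in_wide_levels_if_finite:
  assumes "Card_order r" "infinite (Field r)" "finite ((\<lambda>x. restrict x (underS r a)) ` A)"
  shows "a \<notin> wide_levels r A"
proof -
  have "|(\<lambda>x. restrict x (underS r a)) ` A| \<le>o |Field r|"
    using assms(2,3)
    by (intro ordLess_imp_ordLeq finite_ordLess_infinite card_of_Well_order)
      (simp_all only: Field_card_of not_False_eq_True)
  then have "|(\<lambda>x. restrict x (underS r a)) ` A| \<le>o r"
    using card_of_Field_ordIso[OF assms(1)] by (rule ordLeq_ordIso_trans)
  then show ?thesis by (simp add: wide_levels_def)
qed

section \<open>A level on which the full tree is wide\<close>

text \<open>If \<open>ctwo ^c t\<close> were at most \<open>lam\<close> for every cardinal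
  \<open>t <o lam\<close>, then \<open>lam\<close> would bound these powers and their supremum could
  not exceed it. So some power is larger, and its exponent is replaced by an ordinal below
  \<open>lam\<close>, that is, by a level of the tree.\<close>

lemma two_pow_underS_greater:
  fixes lam :: "'a rel"
  assumes lam: "Card_order lam" and less: "lam <o two_pow_less lam"
  obtains a where "a \<in> Field lam" "\<not> |underS lam a \<rightarrow>\<^sub>E (UNIV :: bool set)| \<le>o lam"
proof -
  \<comment> \<open>A copy of \<open>lam\<close> on the type \<open>'a \<Rightarrow> bool\<close>:
    minimality in \<open>is_card_sup\<close> only compares with upper bounds of that type.\<close>
  let ?k = "|(\<lambda>a b. a = b) ` Field lam| :: ('a \<Rightarrow> bool) rel"
  have "inj_on (\<lambda>a b :: 'a. a = b) (Field lam)"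
    by (rule inj_onI) metis
  then have "|Field lam| =o ?k"
    by (intro card_of_ordIsoI[OF inj_on_imp_bij_betw])
  then have k: "?k =o lam"
    using card_of_Field_ordIso[OF lam] by (meson ordIso_symmetric ordIso_transitive)
  have "\<exists>t :: 'a rel. Card_order t \<and> t <o lam \<and> \<not> ctwo ^c t \<le>o lam"
  proof (rule ccontr)
    assume "\<not> ?thesis"
    then have "\<forall>c\<in>{ctwo ^c t | t :: 'a rel. Card_order t \<and> t <o lam}. c \<le>o ?k"
      using ordIso_symmetric[OF k] by (auto intro: ordLeq_ordIso_trans)
    then have "two_pow_less lam \<le>o ?k"
      using is_card_sup_two_pow_less[of lam] card_of_Card_order unfolding is_card_sup_def by blast
    then have "two_pow_less lam \<le>o lam" using k by (rule ordLeq_ordIso_trans)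
    with less show False by (metis not_ordLess_ordLeq)
  qed
  then obtain t :: "'a rel"
    where t: "Card_order t" "t <o lam" "\<not> ctwo ^c t \<le>o lam" by blast
  have wo: "Well_order lam" "Well_order t"
    using lam t(1) by (auto simp: card_order_on_well_order_on)
  \<comment> \<open>Being smaller than \<open>lam\<close>, the well-order \<open>t\<close> is
    isomorphic to a proper initial segment of it.\<close>
  then obtain a where a: "a \<in> Field lam" "t =o Restr lam (underS lam a)"
    using t(2) ordLess_iff_ordIso_Restr by blast
  have "Field (Restr lam (underS lam a)) = underS lam a"
    using wo(1) by (simp add: Field_Restr_ofilter wo_rel.intro wo_rel.underS_ofilter)
  with a(2) have "|Field t| =o |underS lam a|"
    by (metis card_of_cong)
  then have "t =o |underS lam a|"
    using card_of_Field_ordIso[OF t(1)] by (meson ordIso_symmetric ordIso_transitive)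
  then have "ctwo ^c t =o ctwo ^c |underS lam a|"
    by (intro cexp_cong2 t(1) card_of_Card_order) (simp_all add: ctwo_def card_of_Card_order)
  \<comment> \<open>A literal equality: \<open>Func\<close> and the extensional function space both
    take the value \<open>undefined\<close> off the domain.\<close>
  moreover have "ctwo ^c |underS lam a| = |underS lam a \<rightarrow>\<^sub>E (UNIV :: bool set)|"
    by (simp add: cexp_def ctwo_def Field_card_of Func_def PiE_def Pi_def extensional_def
      Collect_conj_eq)
  ultimately have "\<not> |underS lam a \<rightarrow>\<^sub>E (UNIV :: bool set)| \<le>o lam"
    using t(3) by (metis ordIso_ordLeq_trans)
  with a(1) that show ?thesis by blast
qed

lemma restrict_image_PiE_UNIV:
  fixes A B :: "'a set"
  assumes "A \<subseteq> B"
  shows "(\<lambda>x :: 'a \<Rightarrow> 'b. restrict x A) ` (B \<rightarrow>\<^sub>E UNIV) = A \<rightarrow>\<^sub>E UNIV" (is "?L = ?R")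
proof
  show "?R \<subseteq> ?L"
  proof
    fix s assume "s \<in> ?R"
    \<comment> \<open>The extension of \<open>s\<close> to \<open>B\<close> has the value
      \<open>undefined\<close> on \<open>B - A\<close>, which is admissible since the codomain is
      \<open>UNIV\<close>.\<close>
    then have "s = restrict (restrict s B) A"
      using assms by (simp add: restrict_restrict Int_absorb1 PiE_def extensional_restrict)
    then show "s \<in> ?L"
      by (rule image_eqI[where x = "restrict s B"]) simp
  qed
qed auto

text \<open>Every node of level \<open>a\<close> extends to a branch, so the whole space realizes
  all of \<open>underS lam a \<rightarrow>\<^sub>E UNIV\<close>. This gives the space positive
  measure.\<close>

lemma wide_levels_two_space_nonempty:
  fixes lam :: "'a rel"
  assumes "Card_order lam" "lam <o two_pow_less lam"
  shows "wide_levels lam (two_space lam) \<noteq> {}"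
proof -
  obtain a where a: "a \<in> Field lam" "\<not> |underS lam a \<rightarrow>\<^sub>E (UNIV :: bool set)| \<le>o lam"
    using two_pow_underS_greater[OF assms] .
  moreover have "underS lam a \<subseteq> Field lam"
    by (auto simp: underS_def Field_def)
  ultimately have "a \<in> wide_levels lam (two_space lam)"
    by (simp add: wide_levels_def two_space_def restrict_image_PiE_UNIV)
  then show ?thesis by blast
qed

section \<open>Local bases in the bounded topology\<close>

lemma openin_bounded_topology_cone:
  assumes "a \<in> Field lam"
  shows "openin (bounded_topology lam) (basic_cone lam a (restrict x (underS lam a)))"
  unfolding bounded_topology_def
proof (intro topology_generated_by_Basis CollectI exI conjI)
  show "restrict x (underS lam a) \<in> underS lam a \<rightarrow>\<^sub>E UNIV" by simp
qed (use assms in simp_all)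

lemma wide_levels_local_basis:
  assumes "Card_order lam" "infinite (Field lam)" "x \<in> two_space lam"
    and basis: "open_local_basis (bounded_topology lam) x \<U>"
  shows "(\<Inter>U\<in>\<U>. wide_levels lam U) = {}"
proof (rule equals0I)
  fix a assume a: "a \<in> (\<Inter>U\<in>\<U>. wide_levels lam U)"
  \<comment> \<open>A local basis has a member inside the whole space, so the intersection is not
    the degenerate \<open>UNIV\<close> and \<open>a\<close> really is a level.\<close>
  obtain U0 where "U0 \<in> \<U>"
    using basis assms(2,3) unfolding open_local_basis_def
    by (metis finite.emptyI openin_topspace topspace_bounded_topology)
  with a have aF: "a \<in> Field lam" by (auto simp: wide_levels_def)
  let ?C = "basic_cone lam a (restrict x (underS lam a))"
  have "openin (bounded_topology lam) ?C" "x \<in> ?C"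
    using openin_bounded_topology_cone[OF aF] assms(3) by (auto simp: basic_cone_def)
  then obtain U where U: "U \<in> \<U>" "U \<subseteq> ?C"
    using basis unfolding open_local_basis_def by blast
  have "(\<lambda>y. restrict y (underS lam a)) ` ?C \<subseteq> {restrict x (underS lam a)}"
    by (auto simp: basic_cone_def)
  then have "a \<notin> wide_levels lam ?C"
    by (intro not_in_wide_levels_if_finite assms(1,2)) (rule finite_subset, auto)
  with U a wide_levels_mono[OF U(2)] show False by blast
qed

section \<open>The monoid of coded final segments\<close>

text \<open>
  The injection \<open>(=)\<close> only serves to code final segments, of type \<open>'a set\<close>, in the prescribed
  type of values.
\<close>

definition code :: "'a set \<Rightarrow> ('a \<Rightarrow> bool) set" where
  "code U = (=) ` U"

text \<open>For total \<open>r\<close> the carrier is a chain under inclusion, so the union of two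
  elements is their maximum.\<close>

definition segment_monoid :: "'a rel \<Rightarrow> 'a value_monoid" where
  "segment_monoid r =
     \<lparr>carrier = code ` final_segments r, monoid.mult = (\<union>), one = {},
      leq = {(U, V). U \<in> code ` final_segments r \<and> V \<in> code ` final_segments r \<and> U \<subseteq> V}\<rparr>"

text \<open>Unions exist for arbitrary sequences, so the sum is defined on all of
  \<open>ord_seqs W C\<close>.\<close>

definition union_sum ::
    "'o rel \<Rightarrow> 's set set \<Rightarrow> ('o \<times> ('o \<Rightarrow> 's set) \<rightharpoonup> 's set)" where
  "union_sum W C = (\<lambda>(a, s). if (a, s) \<in> ord_seqs W C then Some (\<Union>i\<in>underS W a. s i) else None)"

definition level_measure :: "'a rel \<Rightarrow> (('a \<Rightarrow> bool) set \<rightharpoonup> ('a \<Rightarrow> bool) set)" where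
  "level_measure lam =
     (\<lambda>A. if A \<subseteq> two_space lam then Some (code (wide_levels lam A)) else None)"

lemma code_subset_iff [simp]: "code U \<subseteq> code V \<longleftrightarrow> U \<subseteq> V"
proof -
  have "inj ((=) :: 'a \<Rightarrow> 'a \<Rightarrow> bool)" by (rule injI) metis
  then show ?thesis by (simp add: code_def inj_image_subset_iff)
qed

lemma code_empty [simp]: "code {} = {}"
  by (simp add: code_def)

lemma code_eq_empty_iff [simp]: "code U = {} \<longleftrightarrow> U = {}"
  by (simp add: code_def)

lemma code_Un: "code (U \<union> V) = code U \<union> code V"
  by (auto simp: code_def)

lemma code_UN: "code (\<Union>i\<in>I. U i) = (\<Union>i\<in>I. code (U i))"
  by (auto simp: code_def)

lemma UN_in_code_final_segments:
  assumes "\<And>i. i \<in> I \<Longrightarrow> s i \<in> code ` final_segments r"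
  shows "(\<Union>i\<in>I. s i) \<in> code ` final_segments r"
proof -
  have "\<forall>i\<in>I. \<exists>U. U \<in> final_segments r \<and> s i = code U"
    using assms by auto
  then obtain U where U: "\<forall>i\<in>I. U i \<in> final_segments r \<and> s i = code (U i)"
    by (rule bchoice[THEN exE])
  then have "(\<Union>i\<in>I. s i) = code (\<Union>i\<in>I. U i)"
    by (simp add: code_UN)
  then show ?thesis
    using U by (auto intro!: imageI UN_in_final_segments)
qed

lemma positively_totally_ordered_segment_monoid:
  assumes "Total r" "Field r \<noteq> {}"
  shows "positively_totally_ordered_monoid (segment_monoid r)"
proof -
  let ?C = "code ` final_segments r"
  have Un: "U \<union> V \<in> ?C" if "U \<in> ?C" "V \<in> ?C" for U V
    using that by (auto simp flip: code_Un intro!: imageI Un_in_final_segments)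
  have empty: "{} \<in> ?C"
    using empty_in_final_segments[of r] by (force simp flip: code_empty)
  let ?S = "segment_monoid r"
  have leq_iff: "(U, V) \<in> leq ?S \<longleftrightarrow> U \<in> ?C \<and> V \<in> ?C \<and> U \<subseteq> V" for U V
    by (simp add: segment_monoid_def)
  have S: "carrier ?S = ?C" "\<one>\<^bsub>?S\<^esub> = {}" "monoid.mult ?S = (\<union>)"
    by (simp_all add: segment_monoid_def)
  show ?thesis
    unfolding positively_totally_ordered_monoid_def S
  proof (intro conjI allI impI ballI)
    show "Group.monoid ?S"
      using Un empty by unfold_locales (auto simp: segment_monoid_def)
    show "linear_order_on ?C (leq ?S)"
      using final_segments_chain[OF assms(1)]
      by (auto simp: segment_monoid_def order_on_defs refl_on_def trans_def antisym_def
        total_on_def)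
    \<comment> \<open>The segment \<open>Field r\<close> supplies the nonzero element.\<close>
    show "?C \<noteq> {{}}"
      using Field_in_final_segments[of r] assms(2)
      by (metis code_eq_empty_iff image_eqI singletonD)
    show "({}, a) \<in> leq ?S" if "a \<in> ?C" for a
      using that empty by (simp add: leq_iff)
    show "(a \<union> c, b \<union> d) \<in> leq ?S" if "(a, b) \<in> leq ?S" "(c, d) \<in> leq ?S" for a b c d
      using that unfolding leq_iff by (intro conjI Un) blast+
  qed
qed

section \<open>Suprema, infima and the infinitary sum\<close>

lemma is_sup_Union:
  assumes "V \<subseteq> carrier (segment_monoid r)" "\<Union>V \<in> carrier (segment_monoid r)"
  shows "is_sup (segment_monoid r) V (\<Union>V)"
  using assms by (auto simp: is_sup_def segment_monoid_def)

text \<open>A lower bound is the code of a segment contained in every \<open>U i\<close>, hence in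
  their empty intersection. This is the form in which points get measure zero as an infimum.\<close>

lemma is_inf_empty:
  assumes "\<And>i. i \<in> I \<Longrightarrow> U i \<in> final_segments r" "(\<Inter>i\<in>I. U i) = {}"
  shows "is_inf (segment_monoid r) ((\<lambda>i. code (U i)) ` I) {}"
proof -
  have "{} \<in> code ` final_segments r"
    using empty_in_final_segments[of r] by (force simp flip: code_empty)
  moreover have "V = {}" if "\<forall>i\<in>I. V \<subseteq> U i" for V
    using that assms(2) by blast
  ultimately show ?thesis
    using assms(1) by (auto simp: is_inf_def segment_monoid_def)
qed

lemma foldr_Un: "foldr (\<union>) (map s l) {} = (\<Union>i\<in>set l. s i)"
  by (induction l) auto

lemma infinitary_sum_union_sum:
  fixes W :: "'o rel"
  assumes W: "trans W" "antisym W"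
  shows "infinitary_sum W (segment_monoid r) (union_sum W (carrier (segment_monoid r)))"
proof -
  let ?C = "carrier (segment_monoid r)"
  have C: "?C = code ` final_segments r" by (simp add: segment_monoid_def)
  have dom: "dom (union_sum W ?C) = ord_seqs W ?C"
    by (auto simp: union_sum_def split: if_splits)
  have closed: "(\<Union>i\<in>I. s i) \<in> ?C" if "\<And>i. i \<in> I \<Longrightarrow> s i \<in> ?C" for I :: "'o set" and s
    using that unfolding C by (rule UN_in_code_final_segments)
  have ran: "ran (union_sum W ?C) \<subseteq> ?C"
  proof
    fix v assume "v \<in> ran (union_sum W ?C)"
    then obtain a s where "(a, s) \<in> ord_seqs W ?C" "v = (\<Union>i\<in>underS W a. s i)"
      by (auto simp: ran_def union_sum_def split: if_splits)
    then show "v \<in> ?C"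
      using closed[of "underS W a" s] by (simp add: ord_seqs_def PiE_iff)
  qed
  have sup: "is_sup (segment_monoid r)
      {v. \<exists>c\<in>underS W a. union_sum W ?C (c, restrict s (underS W c)) = Some v}
      (the (union_sum W ?C (a, s)))"
    (is "is_sup _ ?V _")
    if as: "(a, s) \<in> ord_seqs W ?C" and lim: "limit_ord W a"
      and cof: "\<forall>b\<in>underS W a. \<exists>c\<in>underS W a. (b, c) \<in> W \<and>
        (c, restrict s (underS W c)) \<in> ord_seqs W ?C" for a s
  proof -
    have sum: "union_sum W ?C (a, s) = Some (\<Union>i\<in>underS W a. s i)"
      using as by (simp add: union_sum_def)
    have in_C: "(\<Union>i\<in>underS W a. s i) \<in> ?C"
      using as closed[of "underS W a" s] by (simp add: ord_seqs_def PiE_iff)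
    have V: "?V = {(\<Union>i\<in>underS W c. s i) | c.
        c \<in> underS W a \<and> (c, restrict s (underS W c)) \<in> ord_seqs W ?C}"
      by (auto simp: union_sum_def split: if_splits)
    have "?V \<subseteq> ?C"
      using ran by (auto simp: ran_def)
    moreover have "\<Union>?V = (\<Union>i\<in>underS W a. s i)"
    proof
      show "(\<Union>i\<in>underS W a. s i) \<subseteq> \<Union>?V"
      proof (rule UN_least)
        \<comment> \<open>The limit property gives \<open>b\<close> strictly between
          \<open>i\<close> and \<open>a\<close>, and cofinality gives a summable initial segment of
          length at least \<open>b\<close>, which therefore includes index \<open>i\<close>.\<close>
        fix i assume "i \<in> underS W a"
        then obtain b where b: "b \<in> underS W a" "i \<in> underS W b"
          using lim unfolding limit_ord_def by blast
        then obtain c where c: "c \<in> underS W a" "(b, c) \<in> W"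
          "(c, restrict s (underS W c)) \<in> ord_seqs W ?C"
          using cof by blast
        have "i \<in> underS W c"
          using underS_mono_trans_antisym[OF W c(2)] b(2) by blast
        with c(1,3) show "s i \<subseteq> \<Union>?V" unfolding V by blast
      qed
      show "\<Union>?V \<subseteq> (\<Union>i\<in>underS W a. s i)"
      proof -
        have "underS W c \<subseteq> underS W a" if "c \<in> underS W a" for c
          using that by (intro underS_mono_trans_antisym[OF W]) (simp add: underS_def)
        then show ?thesis unfolding V by blast
      qed
    qed
    ultimately show ?thesis
      using is_sup_Union[of ?V r] in_C sum by auto
  qed
  show ?thesis
    unfolding infinitary_sum_def dom
  proof (intro conjI allI impI)
    fix a s assume "(a, s) \<in> ord_seqs W ?C" "underS W a = {}"
    then show "union_sum W ?C (a, s) = Some \<one>\<^bsub>segment_monoid r\<^esub>"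
      by (simp add: union_sum_def segment_monoid_def)
  next
    fix a s l assume "(a, s) \<in> ord_seqs W ?C" "set l = underS W a"
    then show "union_sum W ?C (a, s) =
        Some (foldr (\<otimes>\<^bsub>segment_monoid r\<^esub>) (map s l) \<one>\<^bsub>segment_monoid r\<^esub>)"
      by (simp add: union_sum_def foldr_Un segment_monoid_def)
  qed (use ran sup in simp_all)
qed

section \<open>The measure axioms\<close>

text \<open>Families of length below the successor cardinal thus have at most \<open>lam\<close>
  members, as \<open>wide_levels_UN\<close> requires.\<close>

lemma card_underS_cardSuc:
  assumes "Card_order lam" "g \<in> Field (cardSuc lam)"
  shows "|underS (cardSuc lam) g| \<le>o lam"
  using card_of_underS[OF cardSuc_Card_order[OF assms(1)] assms(2)]
  by (simp add: cardSuc_ordLeq_ordLess[OF assms(1) card_of_Card_order])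

text \<open>All subsets of the space are measured, so the closure conditions on the family are
  immediate. The remaining axioms come from \<open>wide_levels_mono\<close>,
  \<open>wide_levels_UN\<close>, \<open>wide_levels_two_space_nonempty\<close> and
  \<open>wide_levels_local_basis\<close>.\<close>

lemma weak_measure_space_level_measure:
  fixes lam :: "'a rel"
  assumes lam: "Card_order lam" "infinite (Field lam)" "lam <o two_pow_less lam"
  shows "weak_measure_space lam (segment_monoid lam)
    (union_sum (cardSuc lam) (carrier (segment_monoid lam)))
    (bounded_topology lam) (Pow (two_space lam)) (level_measure lam)"
proof -
  let ?S = "segment_monoid lam" and ?X = "bounded_topology lam"
  have "Well_order lam" using lam(1) by (rule card_order_on_well_order_on)
  then have lo: "trans lam" "antisym lam" by (auto simp: order_on_defs)
  have top: "topspace ?X = two_space lam"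
    using lam(2) by (intro topspace_bounded_topology) auto
  have wide: "code (wide_levels lam A) \<in> carrier ?S" for A
    using wide_levels_final_segment[OF lo] by (simp add: segment_monoid_def)
  have mu: "level_measure lam A = Some (code (wide_levels lam A))" if "A \<subseteq> two_space lam" for A
    using that by (simp add: level_measure_def)
  have null: "wide_levels lam A = {}" if "finite A" for A
    using not_in_wide_levels_if_finite[OF lam(1,2)] that by (force simp: wide_levels_def)
  have leq_iff: "(code (wide_levels lam A), code (wide_levels lam B)) \<in> leq ?S
      \<longleftrightarrow> wide_levels lam A \<subseteq> wide_levels lam B" for A B
    using wide by (simp add: segment_monoid_def)
  show ?thesis
    unfolding weak_measure_space_def top
  proof (intro conjI ballI allI impI)
    show "weakly_measurable_space lam ?X (Pow (two_space lam))"
      unfolding weakly_measurable_space_def top using openin_subset[of ?X] top by blast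
    show "Pow (two_space lam) \<subseteq> dom (level_measure lam)"
      "dom (level_measure lam) \<subseteq> Pow (two_space lam)" "ran (level_measure lam) \<subseteq> carrier ?S"
      using wide by (auto simp: level_measure_def ran_def split: if_splits)
    show "level_measure lam {} = Some \<one>\<^bsub>?S\<^esub>"
      by (simp add: mu null segment_monoid_def)
    \<comment> \<open>Zero is the code of \<open>wide_levels lam {}\<close>, so
      \<open>leq_iff\<close> applies to it.\<close>
    show "(\<one>\<^bsub>?S\<^esub>, the (level_measure lam (two_space lam))) \<in> leq ?S"
      using leq_iff[of "{}"] by (simp add: mu null) (simp add: segment_monoid_def)
    show "the (level_measure lam (two_space lam)) \<noteq> \<one>\<^bsub>?S\<^esub>"
      using wide_levels_two_space_nonempty[OF lam(1,3)] by (simp add: mu segment_monoid_def)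
  next
    fix A B assume "A \<in> Pow (two_space lam)" "B \<in> Pow (two_space lam)" "A \<subseteq> B"
    then show "(the (level_measure lam A), the (level_measure lam B)) \<in> leq ?S"
      using wide_levels_mono[of A B] by (simp add: mu leq_iff)
  next
    fix g and A :: "'a set \<Rightarrow> ('a \<Rightarrow> bool) set"
    let ?I = "underS (cardSuc lam) g"
    let ?s = "\<lambda>i\<in>?I. the (level_measure lam (A i))"
    assume g: "g \<in> Field (cardSuc lam)" and A: "\<forall>i\<in>?I. A i \<in> Pow (two_space lam)"
    have seq: "(g, ?s) \<in> ord_seqs (cardSuc lam) (carrier ?S)"
      using g A wide by (auto simp: ord_seqs_def mu)
    then show "(g, ?s) \<in> dom (union_sum (cardSuc lam) (carrier ?S))"
      by (simp add: union_sum_def dom_def)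
    have "(\<Union>i\<in>?I. A i) \<subseteq> two_space lam" using A by auto
    moreover have "wide_levels lam (\<Union>i\<in>?I. A i) = (\<Union>i\<in>?I. wide_levels lam (A i))"
      by (rule wide_levels_UN[OF lam(1,2) card_underS_cardSuc[OF lam(1) g]])
    ultimately show "level_measure lam (\<Union>i\<in>?I. A i) =
        union_sum (cardSuc lam) (carrier ?S) (g, ?s)"
      using A seq by (simp add: union_sum_def mu code_UN)
  next
    fix x g and A :: "'a set \<Rightarrow> ('a \<Rightarrow> bool) set"
    let ?I = "underS (cardSuc lam) g"
    assume x: "x \<in> two_space lam" and basis: "open_local_basis ?X x (A ` ?I)"
    have A: "A i \<subseteq> two_space lam" if "i \<in> ?I" for i
      using basis that unfolding open_local_basis_def by (metis imageI openin_subset top)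
    have "(\<Inter>i\<in>?I. wide_levels lam (A i)) = {}"
      using wide_levels_local_basis[OF lam(1,2) x basis] by (simp add: image_image)
    \<comment> \<open>By \<open>null\<close>, \<open>{}\<close> is also the measure of the point
      \<open>x\<close>.\<close>
    then have "is_inf ?S ((\<lambda>i. code (wide_levels lam (A i))) ` ?I) {}"
      by (intro is_inf_empty wide_levels_final_segment[OF lo])
    then show "is_inf ?S ((\<lambda>i. the (level_measure lam (A i))) ` ?I) (the (level_measure lam {x}))"
      using x A by (simp add: mu null cong: image_cong_simp)
  qed
qed

theorem corollary8p6:
  fixes lam :: "'a rel"
  assumes "Card_order lam" and "infinite (Field lam)"
    and "lam <o two_pow_less lam"
  shows "\<exists>(S :: 'a value_monoid) ssum M mu.
      positively_totally_ordered_monoid S \<and>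
      infinitary_sum (cardSuc lam) S ssum \<and>
      weak_measure_space lam S ssum (bounded_topology lam) M mu \<and>
      continuous_measure S (bounded_topology lam) M mu"
proof (intro exI conjI)
  have "Well_order lam" "Well_order (cardSuc lam)"
    using assms(1) by (auto intro: card_order_on_well_order_on cardSuc_Card_order)
  then have wo: "Total lam" "trans (cardSuc lam)" "antisym (cardSuc lam)"
    by (auto simp: order_on_defs)
  have ne: "Field lam \<noteq> {}" using assms(2) by auto
  show "positively_totally_ordered_monoid (segment_monoid lam)"
    using wo(1) ne by (rule positively_totally_ordered_segment_monoid)
  show "infinitary_sum (cardSuc lam) (segment_monoid lam)
      (union_sum (cardSuc lam) (carrier (segment_monoid lam)))"
    using wo(2,3) by (rule infinitary_sum_union_sum)
  show "weak_measure_space lam (segment_monoid lam)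
      (union_sum (cardSuc lam) (carrier (segment_monoid lam)))
      (bounded_topology lam) (Pow (two_space lam)) (level_measure lam)"
    using assms by (rule weak_measure_space_level_measure)
  \<comment> \<open>A point contributes a single node to each level.\<close>
  have "wide_levels lam {x} = {}" for x
    using not_in_wide_levels_if_finite[OF assms(1,2), of _ "{x}"] by auto
  then show "continuous_measure (segment_monoid lam) (bounded_topology lam)
      (Pow (two_space lam)) (level_measure lam)"
    unfolding continuous_measure_def topspace_bounded_topology[OF ne]
    by (simp add: level_measure_def segment_monoid_def)
qed

end
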